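(* Let $c\geq 1$, $a\in\mathbb{N}$, and let $(k_i)_{i\in\mathbb{N}}$ be an unbounded sequence of integers with $2\leq k_1\leq k_2\leq\cdots$. Define $W_0=1$ and $W_i=\mathbf{W}(k_i^2,c^{W_0W_1\cdots W_{i-1}})$ for $i\in\mathbb{N}$. Let $l_1,l_2,\dots$ be positive integers such that for every $i\geq2$, $l_i>(W_1-1)l_1+\cdots+(W_{i-1}-1)l_{i-1}$. Let \[ A=\{a+x_1l_1+\cdots+x_il_i \mid i\in\mathbb{N},\ 0\leq x_j\leq W_j-1\ (1\le j\le i)\},\qquad B=\{x_1l_1+\cdots+x_il_i \mid i\in\mathbb{N},\ 0\leq x_j\leq W_j-1\ (1\le j\le i)\}, \] and let $\chi\colon A\cup B\to[c]$ be a coloring. Then there is a color $\gamma\in[c]$ such that either (i) there exist positive integers $a_i,d_i$ ($i\in\mathbb{N}$) such that the set \[ C=\{a_i+x_1d_1+\cdots+x_id_i \mid i\in\mathbb{N},\ 0\leq x_j\leq k_j-1\ (1\le j\le i)\} \] satisfies $C\subseteq A$, $\{d_i\mid i\in\mathbb{N}\}\subseteq B$, and $C\cup\{d_i\mid i\in\mathbb{N}\}$ is $\chi$-monochromatic with color $\gamma$; or (ii) there exist positive integers $b$ and $l_1^*,l_2^*,\dots$ with $l_i^*>(W_1-1)l_1^*+\cdots+(W_{i-1}-1)l_{i-1}^*$ for all $i\geq 2$, such that the sets \[ D=\{b+x_1l_1^*+\cdots+x_il_i^* \mid i\in\mathbb{N},\ 0\leq x_j\leq W_j-1\},\qquad E=\{x_1l_1^*+\cdots+x_il_i^*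 \mid i\in\mathbb{N},\ 0\leq x_j\leq W_j-1\} \] satisfy $D\cup E\subseteq B$ and $\chi(D\cup E)\subseteq[c]\setminus\{\gamma\}$ (so $\chi$ uses at most $c-1$ colors on $D\cup E$).
   Context: $\mathbb{N}$ is the set of positive integers and $[c]=\{1,\dots,c\}$. For integers $k\geq 2$ and $c\geq 1$, $\mathbf{W}(k,c)$ denotes the van der Waerden number: the least integer $N$ such that every $c$-coloring of $\{1,\dots,N\}$ contains a monochromatic arithmetic progression of length $k$.
   Formalization: The value 0 (all x_j = 0) is excluded from B and E, since with 0 in them the claim fails: c=2, a=1, all l_i even, color 1 on A and at 0, color 2 on the positive elements of B. *)

theory Defs
  imports Complex_Main "HOL-Library.FuncSet"
begin

definition arith_prog :: "nat \<Rightarrow> nat \<Rightarrow> nat \<Rightarrow> nat set" where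
  "arith_prog k s d = {s + t * d | t. t < k}"

definition monochromatic :: "(nat \<Rightarrow> nat) \<Rightarrow> nat set \<Rightarrow> nat \<Rightarrow> bool" where
  "monochromatic f S \<gamma> \<longleftrightarrow> (\<forall>x\<in>S. f x = \<gamma>)"

definition vdW_property :: "nat \<Rightarrow> nat \<Rightarrow> nat \<Rightarrow> bool" where
  "vdW_property k c N \<longleftrightarrow>
     (\<forall>f \<in> {1..N} \<rightarrow> {1..c}. \<exists>s d \<gamma>. d > 0 \<and> arith_prog k s d \<subseteq> {1..N} \<and>
        monochromatic f (arith_prog k s d) \<gamma>)"

definition vdW_number :: "nat \<Rightarrow> nat \<Rightarrow> nat" where
  "vdW_number k c = (LEAST N. vdW_property k c N)"

text \<open>
  Sequences indexed by the positive integers are functions on \<^typ>\<open>nat\<close> whose value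
  at 0 is not used. The offset may depend on the number \<^term>\<open>i\<close> of summands;
  it is a constant function in all uses but one.
\<close>

definition box_sums :: "(nat \<Rightarrow> nat) \<Rightarrow> (nat \<Rightarrow> nat) \<Rightarrow> (nat \<Rightarrow> nat) \<Rightarrow> nat set" where
  "box_sums a m l = {a i + (\<Sum>j=1..i. x j * l j) | i x. i \<ge> 1 \<and> (\<forall>j\<in>{1..i}. x j < m j)}"

text \<open>
  With offset 0 the all-zero choice of coefficients yields the number 0. Colored sets are
  sets of positive integers, so this degenerate value has to be discarded. This
  cannot be avoided: let \<open>c = 2\<close>, \<open>a = 1\<close>, let all \<open>l\<^sub>i\<close> be even, and give color 1 to
  all of \<open>A\<close> (odd numbers) and to 0, and color 2 to all positive elements of \<open>B\<close>. If 0
  counted as an element of \<open>B\<close> and \<open>E\<close>, then the first alternative would fail, as \<open>C\<close> has color 1 and every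
  \<open>d\<^sub>i\<close> has color 2, and the second would fail, as \<open>0 \<in> E\<close> has color 1 and \<open>b \<in> D\<close> has color 2.
  The number 0 lies in no other set that occurs.
\<close>

definition pos_box_sums :: "(nat \<Rightarrow> nat) \<Rightarrow> (nat \<Rightarrow> nat) \<Rightarrow> nat set" where
  "pos_box_sums m l = box_sums (\<lambda>_. 0) m l - {0}"

end

theory Submission
  imports Defs
begin

text \<open>
  Van der Waerden's theorem, applied coordinate by coordinate, gives for every \<open>n\<close> a
  monochromatic box in the first \<open>n\<close> coordinates of \<open>A\<close>, with sides of length \<open>k\<^sub>j\<^sup>2\<close> in
  directions \<open>e\<^sub>j l\<^sub>j\<close>; by compactness the \<open>e\<^sub>j\<close> and the color \<open>\<gamma>\<close> can be chosen independently of
  \<open>n\<close>. Now consider the sums \<open>\<Sum> y\<^sub>j e\<^sub>j l\<^sub>j\<close> with \<open>0 \<le> y\<^sub>j \<le> k\<^sub>j\<close>, all of which lie in \<open>B\<close>. If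
  sums of color \<open>\<gamma>\<close> occur with arbitrarily late support, then infinitely many of them with
  successive supports serve as the \<open>d\<^sub>i\<close>: since \<open>(k\<^sub>i - 1) k\<^sub>j < k\<^sub>j\<^sup>2\<close> for \<open>i \<le> j\<close>, their
  combinations stay inside the boxes. Otherwise all sums supported beyond some \<open>m\<close> avoid \<open>\<gamma>\<close>, and
  \<open>l\<^sub>i\<^sup>* = e\<^sub>j l\<^sub>j\<close> for sufficiently sparse indices \<open>j > m\<close> with \<open>k\<^sub>j \<ge> W\<^sub>i\<close> gives the second
  alternative.
\<close>

section \<open>Van der Waerden's theorem by color focusing\<close>

lemma arith_prog_mem: "t < k \<Longrightarrow> s + t * d \<in> arith_prog k s d"
  by (auto simp: arith_prog_def)

text \<open>Recoloring through an injection of \<open>S\<close> into \<open>{1..c}\<close> lets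
  whole colorings of a block or a box serve as colors. The common color is expressed by pairwise
  equality, so that it need not be named.\<close>

lemma vdW_property_finite_colors:
  fixes f :: "nat \<Rightarrow> 'b"
  assumes "vdW_property k c N" "finite S" "card S \<le> c" "f \<in> {1..N} \<rightarrow> S"
  obtains s d where "d > 0" "arith_prog k s d \<subseteq> {1..N}"
    "\<And>x y. x \<in> arith_prog k s d \<Longrightarrow> y \<in> arith_prog k s d \<Longrightarrow> f x = f y"
proof -
  obtain h where h: "inj_on h S" "h ` S \<subseteq> {1..c}"
    using card_le_inj[of S "{1..c}"] assms by auto
  have "h \<circ> f \<in> {1..N} \<rightarrow> {1..c}"
    using assms(4) h(2) by (force simp: Pi_iff)
  then obtain s d \<gamma> where *: "d > 0" "arith_prog k s d \<subseteq> {1..N}"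
      "monochromatic (h \<circ> f) (arith_prog k s d) \<gamma>"
    using assms(1) unfolding vdW_property_def by blast
  have "f x = f y" if "x \<in> arith_prog k s d" "y \<in> arith_prog k s d" for x y
  proof (rule inj_onD[OF h(1)])
    show "h (f x) = h (f y)" using *(3) that by (simp add: monochromatic_def)
    show "f x \<in> S" "f y \<in> S" using that *(2) assms(4) by auto
  qed
  with * show thesis using that by blast
qed

text \<open>Pigeonhole: among \<open>c + 1\<close> points two share a color, and any two points form
  a progression of length 2.\<close>

lemma vdW_property_two: "vdW_property 2 c (c + 1)"
  unfolding vdW_property_def
proof
  fix f :: "nat \<Rightarrow> nat" assume f: "f \<in> {1..c+1} \<rightarrow> {1..c}"
  have "\<not> inj_on f {1..c+1}"
    using card_inj_on_le[of f "{1..c+1}" "{1..c}"] f by (auto simp: image_subset_iff Pi_iff)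
  then obtain x y where xy: "x \<in> {1..c+1}" "y \<in> {1..c+1}" "x < y" "f x = f y"
    unfolding inj_on_def by (metis linorder_neqE_nat)
  have "arith_prog 2 x (y - x) = {x, y}"
    using xy(3) by (force simp: arith_prog_def less_2_cases_iff)
  with xy show "\<exists>s d \<gamma>. d > 0 \<and> arith_prog 2 s d \<subseteq> {1..c + 1} \<and>
      monochromatic f (arith_prog 2 s d) \<gamma>"
    by (intro exI[of _ x] exI[of _ "y - x"] exI[of _ "f x"]) (auto simp: monochromatic_def)
qed

text \<open>
  The set \<^term>\<open>T\<close> collects the colors of \<^term>\<open>r\<close> monochromatic progressions of length
  \<^term>\<open>k\<close>, all of which would be continued by the same point \<^term>\<open>p\<close>.
\<close>

definition color_focused :: "nat \<Rightarrow> (nat \<Rightarrow> nat) \<Rightarrow> nat \<Rightarrow> nat \<Rightarrow> bool" where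
  "color_focused k f N r \<longleftrightarrow> (\<exists>p<N. \<exists>T. finite T \<and> card T = r \<and>
     (\<forall>\<gamma>\<in>T. \<exists>d>0. k * d \<le> p \<and> (\<forall>t\<in>{1..k}. f (p - t * d) = \<gamma>)))"

text \<open>Positions start at 0, unlike in \<open>vdW_property\<close>, so that block number
  \<open>n\<close> of length \<open>M\<close> consists exactly of \<open>n * M + j\<close> with
  \<open>j < M\<close>.\<close>

definition has_mono_prog :: "nat \<Rightarrow> (nat \<Rightarrow> nat) \<Rightarrow> nat \<Rightarrow> bool" where
  "has_mono_prog k f N \<longleftrightarrow> (\<exists>s d \<gamma>. d > 0 \<and> arith_prog k s d \<subseteq> {..<N} \<and>
     monochromatic f (arith_prog k s d) \<gamma>)"

lemma has_mono_prog_shift: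
  assumes "has_mono_prog k (\<lambda>j. f (m + j)) M" "m + M \<le> N"
  shows "has_mono_prog k f N"
proof -
  obtain s d \<gamma> where *: "d > 0" "arith_prog k s d \<subseteq> {..<M}"
      "monochromatic (\<lambda>j. f (m + j)) (arith_prog k s d) \<gamma>"
    using assms(1) unfolding has_mono_prog_def by blast
  have eq: "arith_prog k (m + s) d = (\<lambda>j. m + j) ` arith_prog k s d"
    by (force simp: arith_prog_def)
  show ?thesis unfolding has_mono_prog_def
  proof (intro exI conjI)
    show "arith_prog k (m + s) d \<subseteq> {..<N}"
      unfolding eq using *(2) assms(2) by force
    show "monochromatic f (arith_prog k (m + s) d) \<gamma>"
      unfolding eq using *(3) by (simp add: monochromatic_def)
  qed (fact *(1))
qed

text \<open>Completes a progression whose focus \<open>p\<close> already has its color, the case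
  \<open>t = 0\<close>. The points are given backwards from \<open>p\<close>, hence the reversal
  \<open>k - t\<close>.\<close>

lemma has_mono_prog_if_backward:
  assumes "p < N" "d > 0" "k * d \<le> p" "\<forall>t\<in>{0..k}. f (p - t * d) = \<gamma>"
  shows "has_mono_prog (Suc k) f N"
  unfolding has_mono_prog_def
proof (intro exI conjI)
  have *: "p - k * d + t * d = p - (k - t) * d \<and> k - t \<in> {0..k}" if "t < Suc k" for t
  proof -
    have "t * d \<le> k * d" using that by simp
    then show ?thesis using assms(3) by (simp add: diff_mult_distrib)
  qed
  show "monochromatic f (arith_prog (Suc k) (p - k * d) d) \<gamma>"
    unfolding monochromatic_def arith_prog_def using * assms(4) by auto
  show "arith_prog (Suc k) (p - k * d) d \<subseteq> {..<N}"
    unfolding arith_prog_def using * assms(1) by fastforce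
qed (fact assms(2))

text \<open>Induction on \<open>r\<close>. Consecutive blocks of length \<open>M\<close> are colored
  by their entire pattern, and van der Waerden for length \<open>k\<close> yields \<open>k\<close>
  equal blocks in progression. Running the \<open>r\<close> focused progressions diagonally through
  these blocks moves their focus into the next block of the progression, and the copies of the old
  focus supply one more color.\<close>

lemma color_focusing:
  assumes k: "k \<ge> 2" and IH: "\<And>c. \<exists>N. vdW_property k c N"
  shows "\<exists>N. \<forall>f. range f \<subseteq> {1..c} \<longrightarrow> has_mono_prog (Suc k) f N \<or> color_focused k f N r"
proof (induction r)
  case 0
  have "color_focused k f 1 0" for f
    unfolding color_focused_def by (intro exI[of _ 0] conjI exI[of _ "{}"]) auto
  then show ?case by blast
next
  case (Suc r)
  then obtain M where M: "\<And>f. range f \<subseteq> {1..c} \<Longrightarrow>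
      has_mono_prog (Suc k) f M \<or> color_focused k f M r" by blast
  obtain H where H: "vdW_property k (c ^ M) H" using IH by blast
  \<comment> \<open>Room for the blocks \<open>0\<close> to \<open>2 * H\<close>: the equal blocks
    have numbers at most \<open>H\<close>, and the next term of their progression is at most
    \<open>2 * H\<close>.\<close>
  define N where "N = (2 * H + 1) * M"
  have "has_mono_prog (Suc k) f N \<or> color_focused k f N (Suc r)" if f: "range f \<subseteq> {1..c}" for f
  proof -
    \<comment> \<open>Restriction makes the pattern an extensional function, so that the palette
      \<open>S\<close> has at most \<open>c ^ M\<close> elements.\<close>
    define g where "g n = restrict (\<lambda>j. f (n * M + j)) {..<M}" for n
    define S where "S = ({..<M} \<rightarrow>\<^sub>E {1..c})"
    have S: "finite S" "card S \<le> c ^ M"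
      by (auto simp: S_def card_PiE intro: finite_PiE)
    have "f x \<in> {1..c}" for x using f by blast
    then have "g \<in> {1..H} \<rightarrow> S" by (simp add: g_def S_def)
    then obtain s e
      where e: "e > 0" and sub: "arith_prog k s e \<subseteq> {1..H}"
        and mono: "\<And>x y. x \<in> arith_prog k s e \<Longrightarrow> y \<in> arith_prog k s e \<Longrightarrow> g x = g y"
      by (rule vdW_property_finite_colors[OF H S]) (rule that)
    have same: "f ((s + u * e) * M + j) = f (s * M + j)" if "u < k" "j < M" for u j
    proof -
      have "g (s + u * e) = g (s + 0 * e)"
        using that k by (intro mono arith_prog_mem) auto
      from fun_cong[OF this, of j] that show ?thesis by (simp add: g_def)
    qed
    have "s + (k - 1) * e \<le> H"
      using sub arith_prog_mem[of "k - 1" k s e] k by auto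
    \<comment> \<open>Here \<open>k \<ge> 2\<close> bounds the difference \<open>e\<close> by the
      span of the progression, hence by \<open>H\<close>.\<close>
    moreover have "e \<le> (k - 1) * e" using k by (cases "k - 1") auto
    moreover have "k * e = (k - 1) * e + e" using k by (simp add: diff_mult_distrib)
    ultimately have le2H: "s + k * e \<le> 2 * H" by linarith
    have sH: "s \<le> 2 * H" using le2H by simp
    have inN: "n * M + M \<le> N" if "n \<le> 2 * H" for n
    proof -
      have "(n + 1) * M \<le> (2 * H + 1) * M" using that by (intro mult_right_mono) auto
      then show ?thesis by (simp add: N_def algebra_simps)
    qed
    have "range (\<lambda>j. f (s * M + j)) \<subseteq> {1..c}" using f by auto
    from M[OF this] show ?thesis
    proof
      assume "has_mono_prog (Suc k) (\<lambda>j. f (s * M + j)) M"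
      from has_mono_prog_shift[OF this inN[OF sH]] show ?thesis ..
    next
      assume "color_focused k (\<lambda>j. f (s * M + j)) M r"
      then obtain p T where p: "p < M" and T: "finite T" "card T = r"
        and foc: "\<And>\<gamma>. \<gamma> \<in> T \<Longrightarrow> \<exists>d>0. k * d \<le> p \<and> (\<forall>t\<in>{1..k}. f (s * M + (p - t * d)) = \<gamma>)"
        unfolding color_focused_def by blast
      define \<gamma>0 where "\<gamma>0 = f (s * M + p)"
      show ?thesis
      proof (cases "\<gamma>0 \<in> T")
        case True
        then obtain d where d: "d > 0" "k * d \<le> p"
            "\<forall>t\<in>{1..k}. f (s * M + (p - t * d)) = \<gamma>0" using foc by blast
        have "\<forall>t\<in>{0..k}. f (s * M + (p - t * d)) = \<gamma>0"
        proof
          fix t assume "t \<in> {0..k}"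
          then show "f (s * M + (p - t * d)) = \<gamma>0"
            using d(3) by (cases "t = 0") (auto simp: \<gamma>0_def)
        qed
        from has_mono_prog_if_backward[OF p d(1,2), of "\<lambda>j. f (s * M + j)", OF this]
        have "has_mono_prog (Suc k) (\<lambda>j. f (s * M + j)) M" .
        from has_mono_prog_shift[OF this inN[OF sH]] show ?thesis ..
      next
        case False
        \<comment> \<open>The place of \<open>p\<close> in block \<open>s + k * e\<close>, the one
          that continues the progression of equal blocks.\<close>
        define P where "P = (s + k * e) * M + p"
        have "P < N" using inN[OF le2H] p by (simp add: P_def)
        have step: "k * (e * M + d) \<le> P \<and> (\<forall>t\<in>{1..k}. f (P - t * (e * M + d)) = \<gamma>)"
          if d: "k * d \<le> p" "\<forall>t\<in>{1..k}. f (s * M + (p - t * d)) = \<gamma>" for d \<gamma>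
        proof (intro conjI ballI)
          show "k * (e * M + d) \<le> P" using d(1) by (simp add: P_def algebra_simps)
          fix t assume t: "t \<in> {1..k}"
          have td: "t * d \<le> p" using t d(1) mult_le_mono1[of t k d] by (meson atLeastAtMost_iff le_trans)
          \<comment> \<open>Going back \<open>t\<close> steps of \<open>e * M + d\<close> from
            \<open>P\<close> lands in block \<open>s + u * e\<close> with \<open>u < k\<close>,
            which looks like block \<open>s\<close>.\<close>
          obtain u where u: "k = t + u" using t by (auto simp: le_iff_add)
          have "P - t * (e * M + d) = (s + u * e) * M + (p - t * d)"
            using td by (simp add: P_def u algebra_simps)
          then have "f (P - t * (e * M + d)) = f (s * M + (p - t * d))"
            using same[of u "p - t * d"] u t p by auto
          with d(2) t show "f (P - t * (e * M + d)) = \<gamma>" by simp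
        qed
        have "color_focused k f N (Suc r)"
          unfolding color_focused_def
        proof (rule exI[of _ P], intro conjI exI[of _ "insert \<gamma>0 T"] ballI)
          show "P < N" by fact
          show "finite (insert \<gamma>0 T)" "card (insert \<gamma>0 T) = Suc r" using T False by auto
          fix \<gamma> assume "\<gamma> \<in> insert \<gamma>0 T"
          then show "\<exists>d>0. k * d \<le> P \<and> (\<forall>t\<in>{1..k}. f (P - t * d) = \<gamma>)"
          proof
            assume "\<gamma> = \<gamma>0"
            \<comment> \<open>The choice \<open>d = 0\<close>, that is difference
              \<open>e * M\<close>, runs through the copies of \<open>p\<close> itself and
              contributes the new color.\<close>
            then show ?thesis using step[of 0 \<gamma>] e p by (intro exI[of _ "e * M"]) (auto simp: \<gamma>0_def)
          next
            assume "\<gamma> \<in> T"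
            then obtain d where "d > 0" "k * d \<le> p" "\<forall>t\<in>{1..k}. f (s * M + (p - t * d)) = \<gamma>"
              using foc by blast
            then show ?thesis using step[of d \<gamma>] by (intro exI[of _ "e * M + d"]) auto
          qed
        qed
        then show ?thesis ..
      qed
    qed
  qed
  then show ?case by blast
qed

text \<open>Induction on \<open>k\<close> by color focusing with \<open>r = c + 1\<close>: focused
  progressions in more than \<open>c\<close> distinct colors cannot exist, so a progression of
  length \<open>k + 1\<close> remains.\<close>

theorem van_der_Waerden:
  assumes "k \<ge> 2" shows "\<exists>N. vdW_property k c N"
  using assms
proof (induction k arbitrary: c rule: dec_induct)
  case base
  show ?case using vdW_property_two by blast
next
  case (step k)
  obtain N where N: "\<And>f. range f \<subseteq> {1..c} \<Longrightarrow>
      has_mono_prog (Suc k) f N \<or> color_focused k f N (Suc c)"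
    using color_focusing[OF step(1) step.IH, of c "Suc c"] by blast
  have nofoc: "\<not> color_focused k f N (Suc c)" if f: "range f \<subseteq> {1..c}" for f
  proof
    assume "color_focused k f N (Suc c)"
    then obtain p T where T: "card T = Suc c"
      and foc: "\<And>\<gamma>. \<gamma> \<in> T \<Longrightarrow> \<exists>d>0. k * d \<le> p \<and> (\<forall>t\<in>{1..k}. f (p - t * d) = \<gamma>)"
      unfolding color_focused_def by blast
    have "T \<subseteq> {1..c}"
    proof
      fix \<gamma> assume "\<gamma> \<in> T"
      then obtain d where "\<forall>t\<in>{1..k}. f (p - t * d) = \<gamma>" using foc by blast
      then have "f (p - 1 * d) = \<gamma>" using step(1) by (metis atLeastAtMost_iff le_trans one_le_numeral order_refl)
      then show "\<gamma> \<in> {1..c}" using f by blast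
    qed
    then have "card T \<le> c" using card_mono[of "{1..c}" T] by simp
    with T show False by simp
  qed
  have "vdW_property (Suc k) c (Suc N)"
    unfolding vdW_property_def
  proof
    fix f :: "nat \<Rightarrow> nat" assume f: "f \<in> {1..Suc N} \<rightarrow> {1..c}"
    \<comment> \<open>Shift to positions from 0. Beyond \<open>N\<close> any legal color does;
      allowing \<open>Suc N\<close> points ensures that \<open>f 1\<close> is one even for
      \<open>N = 0\<close>.\<close>
    define g where "g j = (if j < N then f (Suc j) else f 1)" for j
    have "range g \<subseteq> {1..c}" using f by (auto simp: g_def Pi_iff)
    then have "has_mono_prog (Suc k) g N" using N nofoc by blast
    then obtain s d \<gamma> where *: "d > 0" "arith_prog (Suc k) s d \<subseteq> {..<N}"
        "monochromatic g (arith_prog (Suc k) s d) \<gamma>"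
      unfolding has_mono_prog_def by blast
    have eq: "arith_prog (Suc k) (Suc s) d = Suc ` arith_prog (Suc k) s d"
      by (force simp: arith_prog_def)
    show "\<exists>s d \<gamma>. d > 0 \<and> arith_prog (Suc k) s d \<subseteq> {1..Suc N} \<and>
        monochromatic f (arith_prog (Suc k) s d) \<gamma>"
    proof (intro exI conjI)
      show "arith_prog (Suc k) (Suc s) d \<subseteq> {1..Suc N}" unfolding eq using *(2) by force
      show "monochromatic f (arith_prog (Suc k) (Suc s) d) \<gamma>"
        unfolding eq using *(2,3) by (force simp: monochromatic_def g_def)
    qed (fact *(1))
  qed
  then show ?case by blast
qed

lemma vdW_property_vdW_number: "k \<ge> 2 \<Longrightarrow> vdW_property k c (vdW_number k c)"
  unfolding vdW_number_def using van_der_Waerden by (rule LeastI_ex)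

section \<open>Monochromatic boxes with finitely many sides\<close>

text \<open>
  Color the last coordinate by the whole coloring of the box spanned by the earlier ones, and
  recurse into the fiber over the progression found there.
\<close>

lemma mono_subbox:
  fixes W K l :: "nat \<Rightarrow> nat" and f :: "nat \<Rightarrow> nat"
  assumes vdW: "\<And>i. 1 \<le> i \<Longrightarrow> i \<le> n \<Longrightarrow> vdW_property (K i) (c ^ (\<Prod>j=1..<i. W j)) (W i)"
    and K: "\<And>i. K i \<ge> 1"
    and col: "\<And>x. (\<And>j. j \<in> {1..n} \<Longrightarrow> x j < W j) \<Longrightarrow> f (b + (\<Sum>j=1..n. x j * l j)) \<in> {1..c}"
  shows "\<exists>s e \<gamma>. (\<forall>j\<in>{1..n}. e j > 0 \<and> s j + (K j - 1) * e j < W j) \<and>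
    (\<forall>t. (\<forall>j\<in>{1..n}. t j < K j) \<longrightarrow> f (b + (\<Sum>j=1..n. (s j + t j * e j) * l j)) = \<gamma>)"
  using vdW col
proof (induction n arbitrary: b)
  case 0
  then show ?case by auto
next
  case (Suc n)
  define X where "X = PiE {1..n} (\<lambda>j. {..<W j})"
  \<comment> \<open>Terms of progressions lie in \<open>1..W (Suc n)\<close>, coefficients in
    \<open>0..W (Suc n) - 1\<close>; hence \<open>x - 1\<close>.\<close>
  define g where "g x = restrict (\<lambda>y. f (b + (\<Sum>j=1..n. y j * l j) + (x - 1) * l (Suc n))) X" for x
  have "finite X" unfolding X_def by (intro finite_PiE) auto
  have cardX: "card X = (\<Prod>j=1..<Suc n. W j)"
    by (simp add: X_def card_PiE atLeastLessThanSuc_atLeastAtMost)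
  have col': "f (b + x' * l (Suc n) + (\<Sum>j=1..n. y j * l j)) \<in> {1..c}"
    if "\<And>j. j \<in> {1..n} \<Longrightarrow> y j < W j" "x' < W (Suc n)" for x' y
  proof -
    have "f (b + (\<Sum>j=1..Suc n. (y(Suc n := x')) j * l j)) \<in> {1..c}"
      using that by (intro Suc.prems(2)) auto
    moreover have "(\<Sum>j=1..n. (y(Suc n := x')) j * l j) = (\<Sum>j=1..n. y j * l j)"
      by (intro sum.cong) auto
    ultimately show ?thesis by (simp add: algebra_simps)
  qed
  have "g \<in> {1..W (Suc n)} \<rightarrow> (X \<rightarrow>\<^sub>E {1..c})"
  proof
    fix x assume x: "x \<in> {1..W (Suc n)}"
    have "f (b + (\<Sum>j=1..n. y j * l j) + (x - 1) * l (Suc n)) \<in> {1..c}" if "y \<in> X" for y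
      using col'[of y "x - 1"] that x by (auto simp: X_def PiE_iff algebra_simps)
    then show "g x \<in> (X \<rightarrow>\<^sub>E {1..c})" by (simp add: g_def)
  qed
  moreover have "finite (X \<rightarrow>\<^sub>E {1..c})" using \<open>finite X\<close> by (intro finite_PiE) auto
  moreover have "card (X \<rightarrow>\<^sub>E {1..c}) \<le> c ^ (\<Prod>j=1..<Suc n. W j)"
    using \<open>finite X\<close> cardX by (simp add: card_PiE)
  ultimately obtain s1 e1 where e1: "e1 > 0"
    and sub: "arith_prog (K (Suc n)) s1 e1 \<subseteq> {1..W (Suc n)}"
    and mono: "\<And>x y. x \<in> arith_prog (K (Suc n)) s1 e1 \<Longrightarrow>
        y \<in> arith_prog (K (Suc n)) s1 e1 \<Longrightarrow> g x = g y"
    using vdW_property_finite_colors[OF Suc.prems(1)[of "Suc n"], of "X \<rightarrow>\<^sub>E {1..c}" g]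
    by (metis le_add1 order_refl plus_1_eq_Suc)
  have s1: "s1 \<ge> 1"
    using sub arith_prog_mem[of 0 "K (Suc n)" s1 e1] K[of "Suc n"] by auto
  have s1W: "s1 + (K (Suc n) - 1) * e1 \<le> W (Suc n)"
    using sub arith_prog_mem[of "K (Suc n) - 1" "K (Suc n)" s1 e1] K[of "Suc n"] by auto
  \<comment> \<open>The induction hypothesis is applied in the fiber over the first term
    \<open>s1\<close> only; since the fibers are colored alike, the result transfers to the other
    terms.\<close>
  have "\<exists>s e \<gamma>. (\<forall>j\<in>{1..n}. e j > 0 \<and> s j + (K j - 1) * e j < W j) \<and>
    (\<forall>t. (\<forall>j\<in>{1..n}. t j < K j) \<longrightarrow>
      f (b + (s1 - 1) * l (Suc n) + (\<Sum>j=1..n. (s j + t j * e j) * l j)) = \<gamma>)"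
    using s1 s1W by (intro Suc.IH Suc.prems(1) col') auto
  then obtain s e \<gamma> where se: "\<And>j. j \<in> {1..n} \<Longrightarrow> e j > 0 \<and> s j + (K j - 1) * e j < W j"
    and eq: "\<And>t. (\<forall>j\<in>{1..n}. t j < K j) \<Longrightarrow>
      f (b + (s1 - 1) * l (Suc n) + (\<Sum>j=1..n. (s j + t j * e j) * l j)) = \<gamma>"
    by blast
  show ?case
  proof (intro exI conjI ballI allI impI)
    fix j assume j: "j \<in> {1..Suc n}"
    show "0 < (e(Suc n := e1)) j" using j se e1 by (cases "j = Suc n") auto
    show "(s(Suc n := s1 - 1)) j + (K j - 1) * (e(Suc n := e1)) j < W j"
      using j se s1 s1W by (cases "j = Suc n") auto
  next
    fix t assume t: "\<forall>j\<in>{1..Suc n}. t j < K j"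
    define y where "y = restrict (\<lambda>j. s j + t j * e j) {1..n}"
    have "s j + t j * e j < W j" if j: "j \<in> {1..n}" for j
    proof -
      have "t j * e j \<le> (K j - 1) * e j" using t j by (intro mult_right_mono) force+
      with se[OF j] show ?thesis by linarith
    qed
    then have y: "y \<in> X" by (auto simp: y_def X_def)
    have ysum: "(\<Sum>j=1..n. y j * l j) = (\<Sum>j=1..n. (s j + t j * e j) * l j)"
      by (intro sum.cong) (auto simp: y_def)
    have "g (s1 + t (Suc n) * e1) = g (s1 + 0 * e1)"
      using t K[of "Suc n"] by (intro mono arith_prog_mem) auto
    from fun_cong[OF this, of y] have
      "f (b + (\<Sum>j=1..n. (s j + t j * e j) * l j) + (s1 - 1 + t (Suc n) * e1) * l (Suc n)) =
       f (b + (\<Sum>j=1..n. (s j + t j * e j) * l j) + (s1 - 1) * l (Suc n))"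
      using y s1 by (simp add: g_def ysum[simplified])
    also have "\<dots> = \<gamma>" using eq[of t] t by (simp add: algebra_simps)
    finally have *: "f (b + (\<Sum>j=1..n. (s j + t j * e j) * l j) + (s1 - 1 + t (Suc n) * e1) * l (Suc n)) = \<gamma>" .
    have "(\<Sum>j=1..n. ((s(Suc n := s1 - 1)) j + t j * (e(Suc n := e1)) j) * l j) =
        (\<Sum>j=1..n. (s j + t j * e j) * l j)"
      by (intro sum.cong) auto
    with * show "f (b + (\<Sum>j=1..Suc n. ((s(Suc n := s1 - 1)) j + t j * (e(Suc n := e1)) j) * l j)) = \<gamma>"
      by (simp add: add.assoc)
  qed
qed

section \<open>Compactness: directions and color independent of the number of coordinates\<close>

text \<open>Repeated pigeonhole: \<open>S (Suc i)\<close> is an infinite subset of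
  \<open>S i\<close> on which coordinate \<open>i\<close> is constant, and \<open>v\<close> collects
  these constants.\<close>

lemma bounded_sequences_cluster:
  fixes u :: "nat \<Rightarrow> nat \<Rightarrow> nat"
  assumes bdd: "\<And>n j. u n j \<le> w j"
  obtains v where "\<And>i. \<exists>n\<ge>i. \<forall>j\<le>i. u n j = v j"
proof -
  have "\<exists>S. \<forall>i. infinite (S i) \<and> (S (Suc i) \<subseteq> S i \<and> (\<exists>y. \<forall>n\<in>S (Suc i). u n i = y))"
  proof (rule dependent_nat_choice)
    show "\<exists>S::nat set. infinite S" using infinite_UNIV_nat by blast
  next
    fix S :: "nat set" and i assume S: "infinite S"
    have "finite ((\<lambda>n. u n i) ` S)"
      by (rule finite_subset[of _ "{..w i}"]) (auto simp: bdd)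
    from pigeonhole_infinite[OF S this] obtain n0 where "infinite {n \<in> S. u n i = u n0 i}"
      by blast
    then show "\<exists>S'. infinite S' \<and> S' \<subseteq> S \<and> (\<exists>y. \<forall>n\<in>S'. u n i = y)"
      by (intro exI[of _ "{n \<in> S. u n i = u n0 i}"]) auto
  qed
  then obtain S where inf: "\<And>i. infinite (S i)" and dec: "\<And>i. S (Suc i) \<subseteq> S i"
    and "\<And>i. \<exists>y. \<forall>n\<in>S (Suc i). u n i = y" by blast
  then obtain v where v: "\<And>i n. n \<in> S (Suc i) \<Longrightarrow> u n i = v i" by metis
  have anti: "S j \<subseteq> S i" if "i \<le> j" for i j
    using lift_Suc_antimono_le[of S, OF dec that] .
  show thesis
  proof (rule that)
    fix i
    obtain n where n: "n \<in> S (Suc i)" "n \<ge> i"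
      using inf[of "Suc i"] by (meson finite_nat_set_iff_bounded_le nat_le_linear)
    have "u n j = v j" if "j \<le> i" for j
      using v[of n j] n(1) anti[of "Suc j" "Suc i"] that by auto
    with n(2) show "\<exists>n\<ge>i. \<forall>j\<le>i. u n j = v j" by blast
  qed
qed

text \<open>Only the directions and the color are made independent of \<open>i\<close>. The offset
  \<open>b\<close> still varies, because it contains the start values \<open>s\<close> of all
  \<open>Suc n\<close> coordinates and \<open>n\<close> grows with \<open>i\<close>. This is where
  the varying offsets of the first alternative come from.\<close>

lemma uniform_mono_subboxes:
  fixes W K l :: "nat \<Rightarrow> nat" and \<chi> :: "nat \<Rightarrow> nat"
  assumes vdW: "\<And>i. 1 \<le> i \<Longrightarrow> vdW_property (K i) (c ^ (\<Prod>j=1..<i. W j)) (W i)"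
    and K: "\<And>i. K i \<ge> 2" and a: "a \<ge> 1"
    and col: "\<chi> \<in> box_sums (\<lambda>_. a) W l \<rightarrow> {1..c}"
  obtains e \<gamma> where "\<gamma> \<in> {1..c}" "\<And>j. j \<ge> 1 \<Longrightarrow> e j > 0" "\<And>j. j \<ge> 1 \<Longrightarrow> (K j - 1) * e j < W j"
    "\<And>i. \<exists>b>0. \<forall>t. (\<forall>j\<in>{1..i}. t j < K j) \<longrightarrow>
       b + (\<Sum>j=1..i. t j * (e j * l j)) \<in> box_sums (\<lambda>_. a) W l \<and>
       \<chi> (b + (\<Sum>j=1..i. t j * (e j * l j))) = \<gamma>"
proof -
  let ?A = "box_sums (\<lambda>_. a) W l"
  have inA: "a + (\<Sum>j=1..n. x j * l j) \<in> ?A" if "n \<ge> 1" "\<And>j. j \<in> {1..n} \<Longrightarrow> x j < W j" for n x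
    using that unfolding box_sums_def by blast
  \<comment> \<open>\<open>Suc n\<close> coordinates rather than \<open>n\<close>, since
    \<open>box_sums\<close> only admits nonempty index ranges.\<close>
  define P where "P n s e \<gamma> \<longleftrightarrow>
    (\<forall>j\<in>{1..Suc n}. e j > 0 \<and> s j + (K j - 1) * e j < W j) \<and>
    (\<forall>t. (\<forall>j\<in>{1..Suc n}. t j < K j) \<longrightarrow>
      \<chi> (a + (\<Sum>j=1..Suc n. (s j + t j * e j) * l j)) = \<gamma>)" for n s e \<gamma>
  have "\<exists>s e \<gamma>. P n s e \<gamma>" for n
    unfolding P_def
  proof (rule mono_subbox)
    show "vdW_property (K i) (c ^ (\<Prod>j=1..<i. W j)) (W i)" if "1 \<le> i" for i
      using vdW that .
    show "1 \<le> K i" for i using K[of i] by simp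
    show "\<chi> (a + (\<Sum>j=1..Suc n. x j * l j)) \<in> {1..c}"
      if "\<And>j. j \<in> {1..Suc n} \<Longrightarrow> x j < W j" for x
      using inA[of "Suc n" x] that col by (auto simp del: sum.cl_ivl_Suc)
  qed
  then obtain s e \<gamma> where "\<And>n. P n (s n) (e n) (\<gamma> n)" by metis
  then have se: "\<And>n j. j \<in> {1..Suc n} \<Longrightarrow> e n j > 0 \<and> s n j + (K j - 1) * e n j < W j"
    and mono: "\<And>n t. (\<forall>j\<in>{1..Suc n}. t j < K j) \<Longrightarrow>
      \<chi> (a + (\<Sum>j=1..Suc n. (s n j + t j * e n j) * l j)) = \<gamma> n"
    unfolding P_def by blast+
  have box: "a + (\<Sum>j=1..Suc n. (s n j + t j * e n j) * l j) \<in> ?A"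
    if t: "\<forall>j\<in>{1..Suc n}. t j < K j" for n t
  proof (rule inA)
    fix j assume j: "j \<in> {1..Suc n}"
    have "t j * e n j \<le> (K j - 1) * e n j" using t j by (intro mult_right_mono) force+
    with se[OF j] show "s n j + t j * e n j < W j" by linarith
  qed simp
  have \<gamma>c: "\<gamma> n \<in> {1..c}" for n
  proof -
    have t0: "\<forall>j\<in>{1..Suc n}. 0 < K j" using K by (metis less_le_trans pos2)
    have "\<chi> (a + (\<Sum>j=1..Suc n. (s n j + 0 * e n j) * l j)) \<in> {1..c}"
      using box[OF t0] col by (rule funcset_mem[rotated])
    then show ?thesis using mono[OF t0] by (simp only: )
  qed
  \<comment> \<open>Color and directions are packed into one sequence, with the color in slot 0, so
    that a single limit fixes both.\<close>
  define u where "u n j = (if j = 0 then \<gamma> n else if j \<le> Suc n then e n j else 0)" for n j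
  have "u n j \<le> c + W j" for n j
  proof (cases "j \<noteq> 0 \<and> j \<le> Suc n")
    case True
    have "e n j \<le> (K j - 1) * e n j" using K[of j] by (cases "K j - 1") auto
    moreover have "s n j + (K j - 1) * e n j < W j" using True se[of j n] by auto
    ultimately have "e n j \<le> W j" by linarith
    then show ?thesis using True by (simp add: u_def)
  next
    case False
    then show ?thesis using \<gamma>c[of n] by (auto simp: u_def)
  qed
  then obtain v where v: "\<And>i. \<exists>n\<ge>i. \<forall>j\<le>i. u n j = v j"
    using bounded_sequences_cluster[of u "\<lambda>j. c + W j"] by blast
  have v': "\<exists>n\<ge>i. \<gamma> n = v 0 \<and> (\<forall>j\<in>{1..i}. e n j = v j)" for i
  proof -
    obtain n where n: "n \<ge> i" "\<forall>j\<le>i. u n j = v j" using v by blast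
    have "e n j = v j" if "j \<in> {1..i}" for j using n that by (force simp: u_def)
    moreover have "\<gamma> n = v 0" using n(2) by (force simp: u_def)
    ultimately show ?thesis using n(1) by blast
  qed
  show thesis
  proof (rule that[of "v 0" v])
    show "v 0 \<in> {1..c}" using v'[of 0] \<gamma>c by metis
    fix j :: nat assume j: "j \<ge> 1"
    obtain n where n: "n \<ge> j" "e n j = v j" using v'[of j] j by auto
    show "v j > 0" "(K j - 1) * v j < W j" using se[of j n] n j by auto
  next
    fix i
    obtain n where n: "n \<ge> i" "\<gamma> n = v 0" "\<And>j. j \<in> {1..i} \<Longrightarrow> e n j = v j"
      using v'[of i] by auto
    define b where "b = a + (\<Sum>j=1..Suc n. s n j * l j)"
    have "b + (\<Sum>j=1..i. t j * (v j * l j)) \<in> ?A \<and> \<chi> (b + (\<Sum>j=1..i. t j * (v j * l j))) = v 0"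
      if t: "\<forall>j\<in>{1..i}. t j < K j" for t
    proof -
      \<comment> \<open>Setting the coefficients beyond \<open>i\<close> to 0 leaves a box in the
        first \<open>i\<close> directions.\<close>
      define t' where "t' j = (if j \<le> i then t j else 0)" for j
      have t': "\<forall>j\<in>{1..Suc n}. t' j < K j"
        using t K by (auto simp: t'_def intro: less_le_trans[OF pos2])
      have "(\<Sum>j=1..Suc n. t' j * (e n j * l j)) = (\<Sum>j=1..i. t j * (v j * l j))"
        using n by (intro sum.mono_neutral_cong_right) (auto simp: t'_def)
      moreover have "a + (\<Sum>j=1..Suc n. (s n j + t' j * e n j) * l j) =
          b + (\<Sum>j=1..Suc n. t' j * (e n j * l j))"
        by (simp add: b_def sum.distrib add_mult_distrib mult.assoc del: sum.cl_ivl_Suc)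
      ultimately have "b + (\<Sum>j=1..i. t j * (v j * l j)) =
          a + (\<Sum>j=1..Suc n. (s n j + t' j * e n j) * l j)" by (simp only:)
      then show ?thesis using box[OF t'] mono[OF t'] n(2) by (simp only:)
    qed
    moreover have "b > 0" using a by (simp add: b_def)
    ultimately show "\<exists>b>0. \<forall>t. (\<forall>j\<in>{1..i}. t j < K j) \<longrightarrow>
       b + (\<Sum>j=1..i. t j * (v j * l j)) \<in> ?A \<and> \<chi> (b + (\<Sum>j=1..i. t j * (v j * l j))) = v 0"
      by blast
  qed
qed

section \<open>Sparse subsequences of directions\<close>

lemma strict_mono_large_values:
  fixes k w :: "nat \<Rightarrow> nat"
  assumes "\<And>N. \<exists>i. \<forall>j\<ge>i. k j \<ge> N"
  obtains q where "strict_mono q" "\<And>i. q i > m" "\<And>i. k (q i) \<ge> w i"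
proof -
  have ex: "\<exists>j>p. k j \<ge> N" for p N
  proof -
    obtain i where "\<forall>j\<ge>i. k j \<ge> N" using assms by blast
    then show ?thesis by (intro exI[of _ "max (Suc p) i"]) auto
  qed
  have "\<exists>q. \<forall>i. (q i > m \<and> k (q i) \<ge> w i) \<and> q i < q (Suc i)"
  proof (rule dependent_nat_choice)
    show "\<exists>x>m. k x \<ge> w 0" using ex by blast
    fix x i assume "m < x \<and> w i \<le> k x"
    then show "\<exists>y. (m < y \<and> w (Suc i) \<le> k y) \<and> x < y" using ex[of x "w (Suc i)"] by (meson less_trans)
  qed
  then show thesis using that by (metis strict_mono_Suc_iff)
qed

text \<open>Turns a combination of the sparse directions into one of all directions, with
  coefficient 0 outside the range of \<open>q\<close>; membership in \<open>B\<close> and avoidance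
  of \<open>\<gamma>\<close> are stated in this form.\<close>

lemma sum_strict_mono_reindex:
  fixes q :: "nat \<Rightarrow> nat" and g :: "nat \<Rightarrow> 'a :: comm_semiring_0"
  assumes "strict_mono q" "\<And>i. q i > 0"
  shows "(\<Sum>i\<le>n. x i * g (q i)) =
    (\<Sum>j=1..q n. (if j \<in> q ` {..n} then x (inv q j) else 0) * g j)"
proof -
  have inj: "inj q" using assms(1) by (rule strict_mono_imp_inj_on)
  have "(\<Sum>j=1..q n. (if j \<in> q ` {..n} then x (inv q j) else 0) * g j) =
      (\<Sum>j\<in>q ` {..n}. x (inv q j) * g j)"
    using assms by (intro sum.mono_neutral_cong_right) (auto simp: Suc_le_eq strict_mono_less_eq)
  also have "\<dots> = (\<Sum>i\<le>n. x i * g (q i))"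
    using inj by (subst sum.reindex) (auto simp: inj_on_def)
  finally show ?thesis by simp
qed

lemma sum_strict_mono_subsequence_le:
  fixes q h :: "nat \<Rightarrow> nat"
  assumes "strict_mono q" "\<And>i. q i > 0"
  shows "(\<Sum>j=1..<i. h (q j)) \<le> (\<Sum>p=1..<q i. h p)"
proof -
  have "(\<Sum>j=1..<i. h (q j)) = sum h (q ` {1..<i})"
    using strict_mono_imp_inj_on[OF assms(1)] by (subst sum.reindex) (auto simp: inj_on_def)
  also have "\<dots> \<le> (\<Sum>p=1..<q i. h p)"
    using assms by (intro sum_mono2) (auto simp: Suc_le_eq strict_mono_less)
  finally show ?thesis .
qed

section \<open>The dichotomy on late sums of the box color\<close>

theorem theorem3p1:
  fixes c a :: nat and k W l :: "nat \<Rightarrow> nat" and A B :: "nat set" and \<chi> :: "nat \<Rightarrow> nat"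
  assumes "c \<ge> 1" and "a \<ge> 1"
    and "2 \<le> k 1" and "\<forall>i\<ge>1. k i \<le> k (i + 1)" and "\<not> bdd_above (k ` {1..})"
    and "W 0 = 1" and "\<forall>i\<ge>1. W i = vdW_number ((k i)\<^sup>2) (c ^ (\<Prod>j<i. W j))"
    and "\<forall>i\<ge>1. l i > 0" and "\<forall>i\<ge>2. l i > (\<Sum>j=1..<i. (W j - 1) * l j)"
    and "A = box_sums (\<lambda>_. a) W l" and "B = pos_box_sums W l"
    and "\<chi> \<in> A \<union> B \<rightarrow> {1..c}"
  shows "\<exists>\<gamma>\<in>{1..c}.
      (\<exists>as d C. (\<forall>i\<ge>1. as i > 0 \<and> d i > 0) \<and>
         C = box_sums as k d \<and> C \<subseteq> A \<and> d ` {1..} \<subseteq> B \<and>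
         monochromatic \<chi> (C \<union> d ` {1..}) \<gamma>)
    \<or> (\<exists>b l' D E. b > 0 \<and> (\<forall>i\<ge>1. l' i > 0) \<and>
         (\<forall>i\<ge>2. l' i > (\<Sum>j=1..<i. (W j - 1) * l' j)) \<and>
         D = box_sums (\<lambda>_. b) W l' \<and> E = pos_box_sums W l' \<and>
         D \<union> E \<subseteq> B \<and> \<chi> ` (D \<union> E) \<subseteq> {1..c} - {\<gamma>})"
proof -
  have kmono: "k i \<le> k j" if "1 \<le> i" "i \<le> j" for i j
    using that(2)
  proof (induction j rule: dec_induct)
    case (step n)
    have "k n \<le> k (n + 1)" using assms(4) step(1) that(1) by force
    with step.IH show ?case by simp
  qed simp
  have k2: "k j \<ge> 2" if "j \<ge> 1" for j using kmono[of 1 j] assms(3) that by simp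
  have klarge: "\<exists>i. \<forall>j\<ge>i. k j \<ge> N" for N
  proof -
    obtain i where "i \<ge> 1" "k i > N"
      using assms(5) unfolding bdd_above_def by (auto simp: not_le)
    then show ?thesis using kmono[of i] by (meson less_le_trans less_imp_le)
  qed

  \<comment> \<open>\<open>K 0\<close> is never used; the value 2 only serves to make \<open>K \<ge> 2\<close> hold everywhere.\<close>
  define K where "K j = (if j = 0 then 2 else (k j)\<^sup>2)" for j
  have Kk: "k j < K j" if "j \<ge> 1" for j
    using k2[OF that] that by (simp add: K_def power2_eq_square)
  have K2: "K j \<ge> 2" for j
    using Kk[of j] k2[of j] by (cases "j = 0") (auto simp: K_def)
  have vdW: "vdW_property (K i) (c ^ (\<Prod>j=1..<i. W j)) (W i)" if "i \<ge> 1" for i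
  proof -
    have "(\<Prod>j<i. W j) = (\<Prod>j=1..<i. W j)"
      using that assms(6) by (simp add: lessThan_atLeast0 prod.atLeast_Suc_lessThan)
    then show ?thesis
      using vdW_property_vdW_number[of "K i" "c ^ (\<Prod>j<i. W j)"] K2[of i] assms(7) that
      by (simp add: K_def)
  qed
  have colA: "\<chi> \<in> A \<rightarrow> {1..c}" using assms(12) by auto
  obtain e \<gamma> where \<gamma>: "\<gamma> \<in> {1..c}" and e: "\<And>j. j \<ge> 1 \<Longrightarrow> e j > 0"
    and KeW: "\<And>j. j \<ge> 1 \<Longrightarrow> (K j - 1) * e j < W j"
    and boxes: "\<And>i. \<exists>b>0. \<forall>t. (\<forall>j\<in>{1..i}. t j < K j) \<longrightarrow>
       b + (\<Sum>j=1..i. t j * (e j * l j)) \<in> A \<and> \<chi> (b + (\<Sum>j=1..i. t j * (e j * l j))) = \<gamma>"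
    by (rule uniform_mono_subboxes[where a = a and W = W and l = l, folded assms(10)])
      (erule vdW, rule K2, rule assms(2), rule colA, rule that)
  define P where "P i b \<longleftrightarrow> b > 0 \<and> (\<forall>t. (\<forall>j\<in>{1..i}. t j < K j) \<longrightarrow>
     b + (\<Sum>j=1..i. t j * (e j * l j)) \<in> A \<and>
     \<chi> (b + (\<Sum>j=1..i. t j * (e j * l j))) = \<gamma>)" for i b
  have "\<exists>b. P i b" for i using boxes unfolding P_def .
  then obtain base where "\<And>i. P i (base i)" by metis
  then have base: "base i > 0" "(\<forall>j\<in>{1..i}. t j < K j) \<Longrightarrow>
     base i + (\<Sum>j=1..i. t j * (e j * l j)) \<in> A \<and>
     \<chi> (base i + (\<Sum>j=1..i. t j * (e j * l j))) = \<gamma>" for i t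
    unfolding P_def by blast+
  define g where "g j = e j * l j" for j
  have gpos: "g j > 0" if "j \<ge> 1" for j using e assms(8) that by (simp add: g_def)
  \<comment> \<open>As \<open>k j \<le> K j - 1\<close>, a multiple \<open>y * e j\<close> with
    \<open>y \<le> k j\<close> is an admissible coefficient of \<open>l j\<close>.\<close>
  have keW: "y * e j < W j" if "j \<ge> 1" "y \<le> k j" for y j
  proof -
    have "y * e j \<le> (K j - 1) * e j" using Kk[of j] that by (intro mult_right_mono) auto
    with KeW[OF that(1)] show ?thesis by linarith
  qed
  have inB: "(\<Sum>j=1..M. y j * g j) \<in> B"
    if "\<And>j. j \<ge> 1 \<Longrightarrow> y j \<le> k j" "(\<Sum>j=1..M. y j * g j) > 0" for M y
  proof -
    have "M \<ge> 1" using that(2) by (cases M) auto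
    moreover have "(\<Sum>j=1..M. y j * g j) = 0 + (\<Sum>j=1..M. (y j * e j) * l j)"
      by (simp add: g_def mult.assoc)
    moreover have "\<forall>j\<in>{1..M}. y j * e j < W j" using keW that(1) by simp
    ultimately have "(\<Sum>j=1..M. y j * g j) \<in> box_sums (\<lambda>_. 0) W l"
      unfolding box_sums_def
      by (intro CollectI exI[of _ M] exI[of _ "\<lambda>j. y j * e j"]) simp
    then show ?thesis
      using that(2) unfolding assms(11) pos_box_sums_def by (metis DiffI less_irrefl singletonD)
  qed

  \<comment> \<open>A positive sum of color \<open>\<gamma>\<close> whose coefficients vanish up to
    \<open>m\<close>; whether such sums exist for all \<open>m\<close> decides between the
    alternatives.\<close>
  define H where "H m M y \<longleftrightarrow> M > m \<and> (\<forall>j\<ge>1. y j \<le> k j) \<and> (\<forall>j\<le>m. y j = 0) \<and>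
    (\<Sum>j=1..M. y j * g j) > 0 \<and> \<chi> (\<Sum>j=1..M. y j * g j) = \<gamma>" for m M and y :: "nat \<Rightarrow> nat"
  show ?thesis
  proof (cases "\<forall>m. \<exists>M y. H m M y")
    case True
    then obtain nxt Y where nY: "\<And>m. H m (nxt m) (Y m)" by metis
    \<comment> \<open>Cut points: \<open>d i\<close> will be supported between
      \<open>\<mu> (i - 1) + 1\<close> and \<open>\<mu> i\<close>.\<close>
    define \<mu> where "\<mu> i = (nxt ^^ i) 0" for i
    have \<mu>0: "\<mu> 0 = 0" and \<mu>S: "\<mu> (Suc i) = nxt (\<mu> i)" for i by (simp_all add: \<mu>_def)
    have HS: "H (\<mu> i) (\<mu> (Suc i)) (Y (\<mu> i))" for i using nY[of "\<mu> i"] by (simp add: \<mu>S)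
    have \<mu>less: "\<mu> i < \<mu> (Suc i)" for i using HS[of i] by (simp add: H_def)
    have \<mu>ge: "i \<le> \<mu> i" for i
      by (rule strict_mono_imp_increasing) (simp add: strict_mono_Suc_iff \<mu>less)
    define d where "d i = (\<Sum>j=1..\<mu> i. Y (\<mu> (i - 1)) j * g j)" for i
    have dS: "d (Suc i) = (\<Sum>j=1..\<mu> (Suc i). Y (\<mu> i) j * g j)" for i by (simp add: d_def)
    have d: "d i > 0 \<and> d i \<in> B \<and> \<chi> (d i) = \<gamma>" if "i \<ge> 1" for i
    proof -
      obtain n where n: "i = Suc n" using \<open>i \<ge> 1\<close> by (cases i) auto
      show ?thesis using HS[of n] inB[of "Y (\<mu> n)" "\<mu> (Suc n)"] unfolding n dS H_def by blast
    qed
    \<comment> \<open>The \<open>d p\<close> have successive disjoint supports, so the coefficient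
      at \<open>j\<close> is a single product \<open>x p * Y (\<mu> (p - 1)) j\<close>. There
      \<open>p \<le> j\<close> by \<open>\<mu>ge\<close>, hence \<open>k p \<le> k j\<close> and the
      product is below \<open>(k j)\<^sup>2\<close>: this is what the squared lengths are
      for.\<close>
    have comb: "\<exists>t. (\<forall>j\<in>{1..\<mu> i}. t j < K j) \<and> (\<Sum>p=1..i. x p * d p) = (\<Sum>j=1..\<mu> i. t j * g j)"
      if "\<forall>p\<in>{1..i}. x p < k p" for i x
      using that
    proof (induction i)
      case 0
      then show ?case by (simp add: \<mu>0)
    next
      case (Suc i)
      have "\<forall>p\<in>{1..i}. x p < k p" using Suc.prems by simp
      from Suc.IH[OF this] obtain t where t: "\<forall>j\<in>{1..\<mu> i}. t j < K j"
          "(\<Sum>p=1..i. x p * d p) = (\<Sum>j=1..\<mu> i. t j * g j)" by blast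
      define t' where "t' j = (if j \<le> \<mu> i then t j else x (Suc i) * Y (\<mu> i) j)" for j
      have xk: "x (Suc i) < k (Suc i)" using Suc.prems by simp
      have t'K: "t' j < K j" if j: "j \<in> {1..\<mu> (Suc i)}" for j
      proof (cases "j \<le> \<mu> i")
        case True
        then show ?thesis using t(1) j by (simp add: t'_def)
      next
        case False
        then have "k (Suc i) \<le> k j" using \<mu>ge[of i] by (intro kmono) auto
        then have "x (Suc i) < k j" using xk by linarith
        moreover have "Y (\<mu> i) j \<le> k j" using HS[of i] j by (simp add: H_def)
        moreover have "k j > 0" using k2[of j] j by simp
        ultimately have "x (Suc i) * Y (\<mu> i) j < k j * k j"
          by (meson le_less_trans mult_le_mono2 mult_less_mono1)
        then show ?thesis using False j by (simp add: t'_def K_def power2_eq_square)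
      qed
      have t'sum: "(\<Sum>j=1..\<mu> (Suc i). t' j * g j) =
          (\<Sum>j=1..\<mu> i. t j * g j) + x (Suc i) * d (Suc i)"
      proof -
        have Y0: "Y (\<mu> i) j = 0" if "j \<le> \<mu> i" for j using HS[of i] that by (simp add: H_def)
        have "(\<Sum>j=1..\<mu> (Suc i). t' j * g j) =
            (\<Sum>j=1..\<mu> (Suc i). (if j \<le> \<mu> i then t j else 0) * g j + x (Suc i) * (Y (\<mu> i) j * g j))"
          by (intro sum.cong) (auto simp: t'_def Y0)
        also have "\<dots> = (\<Sum>j=1..\<mu> (Suc i). (if j \<le> \<mu> i then t j else 0) * g j) + x (Suc i) * d (Suc i)"
          by (simp only: sum.distrib sum_distrib_left dS)
        also have "(\<Sum>j=1..\<mu> (Suc i). (if j \<le> \<mu> i then t j else 0) * g j) = (\<Sum>j=1..\<mu> i. t j * g j)"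
          using \<mu>less[of i] by (intro sum.mono_neutral_cong_right) auto
        finally show ?thesis .
      qed
      have "(\<Sum>p=1..Suc i. x p * d p) = (\<Sum>j=1..\<mu> (Suc i). t' j * g j)"
        unfolding t'sum using t(2) by simp
      with t'K show ?case by blast
    qed
    \<comment> \<open>Combinations of \<open>d 1\<close> to \<open>d i\<close> use the first
      \<open>\<mu> i\<close> coordinates, so the offset is that of the box with
      \<open>\<mu> i\<close> sides.\<close>
    define as where "as i = base (\<mu> i)" for i
    have C: "z \<in> A \<and> \<chi> z = \<gamma>" if "z \<in> box_sums as k d" for z
    proof -
      obtain i x where z: "z = as i + (\<Sum>p=1..i. x p * d p)" "\<forall>p\<in>{1..i}. x p < k p"
        using \<open>z \<in> box_sums as k d\<close> unfolding box_sums_def by blast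
      obtain t where "\<forall>j\<in>{1..\<mu> i}. t j < K j" "(\<Sum>p=1..i. x p * d p) = (\<Sum>j=1..\<mu> i. t j * g j)"
        using comb[OF z(2)] by blast
      then show ?thesis using base(2)[of "\<mu> i" t] z(1) by (simp add: as_def g_def)
    qed
    have "\<exists>as d C. (\<forall>i\<ge>1. as i > 0 \<and> d i > 0) \<and> C = box_sums as k d \<and> C \<subseteq> A \<and>
        d ` {1..} \<subseteq> B \<and> monochromatic \<chi> (C \<union> d ` {1..}) \<gamma>"
    proof (intro exI conjI)
      show "\<forall>i\<ge>1. as i > 0 \<and> d i > 0" using base(1) d by (simp add: as_def)
      show "box_sums as k d \<subseteq> A" using C by blast
      show "d ` {1..} \<subseteq> B" using d by auto
      show "monochromatic \<chi> (box_sums as k d \<union> d ` {1..}) \<gamma>"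
        using C d by (auto simp: monochromatic_def)
    qed (rule refl)
    then show ?thesis by (intro bexI[OF _ \<gamma>] disjI1)
  next
    case False
    then obtain m where m: "\<And>M y. \<not> H m M y" by blast
    obtain q where q: "strict_mono q" "\<And>i. q i > m" "\<And>i. k (q i) \<ge> W i"
      using strict_mono_large_values[of k m W] klarge by blast
    have qpos: "q i > 0" for i using q(2)[of i] by simp
    \<comment> \<open>The sequence starts at 0: \<open>l' 0\<close> will serve as \<open>b\<close>,
      the later terms as the new directions.\<close>
    define l' where "l' i = g (q i)" for i
    have l'pos: "l' i > 0" for i using gpos[of "q i"] qpos[of i] by (simp add: l'_def)
    \<comment> \<open>The bound is \<open>x j \<le> W j\<close>, not \<open><\<close>: with
      \<open>W 0 = 1\<close> it allows \<open>x 0 = 1\<close>, which gives \<open>D\<close>, while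
      \<open>x 0 = 0\<close> gives \<open>E\<close>. By the choice of \<open>q\<close> it still
      keeps the coefficients at \<open>q j\<close> within \<open>k (q j)\<close>.\<close>
    have avoid: "z \<in> B \<and> \<chi> z \<in> {1..c} - {\<gamma>}"
      if z: "z = (\<Sum>j\<le>i. x j * l' j)" "z > 0" and x: "\<forall>j\<le>i. x j \<le> W j" for z i x
    proof -
      define y where "y j = (if j \<in> q ` {..i} then x (inv q j) else 0)" for j
      have inv: "inv q (q j) = j" for j using strict_mono_imp_inj_on[OF q(1)] by simp
      have z': "z = (\<Sum>j=1..q i. y j * g j)"
        unfolding z(1) l'_def y_def by (rule sum_strict_mono_reindex[OF q(1) qpos])
      have yk: "y j \<le> k j" for j
        using x q(3) order_trans by (fastforce simp: y_def inv)
      have y0: "\<forall>j\<le>m. y j = 0" using q(2) by (auto simp: y_def not_le[symmetric])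
      have "z \<in> B" using inB[of y "q i"] yk z(2) unfolding z' by blast
      moreover have "\<chi> z \<noteq> \<gamma>" using m[of "q i" y] q(2)[of i] yk y0 z(2) unfolding z' H_def by blast
      ultimately show ?thesis using assms(12) by auto
    qed
    have split0: "x 0 * l' 0 + (\<Sum>j=1..i. x j * l' j) = (\<Sum>j\<le>i. x j * l' j)" for x :: "nat \<Rightarrow> nat" and i
      by (simp add: atMost_atLeast0 sum.atLeast_Suc_atMost)
    have upd: "(\<Sum>j=1..i. (x(0 := v)) j * l' j) = (\<Sum>j=1..i. x j * l' j)" for x i v
      by (intro sum.cong) auto
    have D: "z \<in> B \<and> \<chi> z \<in> {1..c} - {\<gamma>}" if "z \<in> box_sums (\<lambda>_. l' 0) W l'" for z
    proof -
      obtain i x where z: "z = l' 0 + (\<Sum>j=1..i. x j * l' j)" "\<forall>j\<in>{1..i}. x j < W j"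
        using \<open>z \<in> box_sums (\<lambda>_. l' 0) W l'\<close> unfolding box_sums_def by blast
      show ?thesis
      proof (rule avoid)
        show "z = (\<Sum>j\<le>i. (x(0 := 1)) j * l' j)"
          using split0[of "x(0 := 1)" i] upd[of x 1 i] z(1) by simp
        show "z > 0" using l'pos[of 0] z(1) by simp
        show "\<forall>j\<le>i. (x(0 := 1)) j \<le> W j" using z(2) assms(6) by (auto simp: Suc_le_eq less_imp_le)
      qed
    qed
    have E: "z \<in> B \<and> \<chi> z \<in> {1..c} - {\<gamma>}" if "z \<in> pos_box_sums W l'" for z
    proof -
      obtain i x where z: "z = (\<Sum>j=1..i. x j * l' j)" "\<forall>j\<in>{1..i}. x j < W j" "z > 0"
        using \<open>z \<in> pos_box_sums W l'\<close> unfolding pos_box_sums_def box_sums_def by auto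
      show ?thesis
      proof (rule avoid)
        show "z = (\<Sum>j\<le>i. (x(0 := 0)) j * l' j)"
          using split0[of "x(0 := 0)" i] upd[of x 0 i] z(1) by simp
        show "\<forall>j\<le>i. (x(0 := 0)) j \<le> W j" using z(2) by (auto simp: Suc_le_eq less_imp_le)
      qed (fact z(3))
    qed
    have growth: "l' i > (\<Sum>j=1..<i. (W j - 1) * l' j)" if "i \<ge> 2" for i
    proof -
      \<comment> \<open>Since \<open>W j - 1 \<le> k (q j)\<close>, each term is at most the
        corresponding term of \<open>l\<close> at \<open>q j\<close>; the growth condition on
        \<open>l\<close> at \<open>q i \<ge> i\<close> then applies.\<close>
      have "(\<Sum>j=1..<i. (W j - 1) * l' j) \<le> (\<Sum>j=1..<i. (W (q j) - 1) * l (q j))"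
      proof (rule sum_mono)
        fix j
        have "(W j - 1) * e (q j) < W (q j)"
          using keW[of "q j" "W j - 1"] q(3)[of j] qpos[of j] by simp
        then have "(W j - 1) * e (q j) * l (q j) \<le> (W (q j) - 1) * l (q j)"
          by (intro mult_right_mono) auto
        then show "(W j - 1) * l' j \<le> (W (q j) - 1) * l (q j)"
          by (simp add: l'_def g_def mult.assoc)
      qed
      also have "\<dots> \<le> (\<Sum>p=1..<q i. (W p - 1) * l p)"
        by (rule sum_strict_mono_subsequence_le[OF q(1) qpos])
      also have "\<dots> < l (q i)"
        using assms(9) strict_mono_imp_increasing[OF q(1), of i] that by simp
      also have "l (q i) \<le> l' i" using e[of "q i"] qpos[of i] by (simp add: l'_def g_def)
      finally show ?thesis .
    qed
    have "\<exists>b l' D E. b > 0 \<and> (\<forall>i\<ge>1. l' i > 0) \<and>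
         (\<forall>i\<ge>2. l' i > (\<Sum>j=1..<i. (W j - 1) * l' j)) \<and>
         D = box_sums (\<lambda>_. b) W l' \<and> E = pos_box_sums W l' \<and>
         D \<union> E \<subseteq> B \<and> \<chi> ` (D \<union> E) \<subseteq> {1..c} - {\<gamma>}"
    proof (intro exI conjI)
      show "l' 0 > 0" "\<forall>i\<ge>1. l' i > 0" using l'pos by auto
      show "\<forall>i\<ge>2. l' i > (\<Sum>j=1..<i. (W j - 1) * l' j)" using growth by blast
      show "box_sums (\<lambda>_. l' 0) W l' \<union> pos_box_sums W l' \<subseteq> B" using D E by blast
      show "\<chi> ` (box_sums (\<lambda>_. l' 0) W l' \<union> pos_box_sums W l') \<subseteq> {1..c} - {\<gamma>}" using D E by blast
    qed (rule refl)+
    then show ?thesis by (intro bexI[OF _ \<gamma>] disjI2)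
  qed
qed

end
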